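(* Let $(f,s)\colon(X,*,\circ)\rightleftarrows(Y,*,\circ)$ be any split epimorphism of digroups with kernel $K$. The following conditions are equivalent: 1) $(f,s)$ is a split epimorphism in the category of left skew braces; 2) for every $(y,k)\in Y\times K$, (i) $\lambda^X_{s(y)}\colon(X,* )\to(X,* )$ and (ii) $\lambda^X_k\colon(X,* )\to(X,* )$ are group homomorphisms.
   Context: A digroup $(X,*,\circ)$ is a set with two group structures having the same unit $1$; morphisms are maps that are homomorphisms for both laws. $x^{-*}$ denotes the inverse for $*$. For $a\in X$, $\lambda^X_a\colon X\to X$ is $b\mapsto a^{-*}*(a\circ b)$. A left skew brace is a digroup in which $a\circ(b*c)=(a\circ b)*a^{-*}*(a\circ c)$ for all $a,b,c$; equivalently, each $\lambda^X_a$ is a homomorphism for $*$. Left skew braces form a full subcategory of digroups. A split epimorphism $(f,s)\colon X\rightleftarrows Y$ consists of morphisms $f\colon X\to Y$, $s\colon Y\to X$ with $fs=\mathrm{Id}_Y$; $K=f^{-1}(1)$. *)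

theory Defs
  imports "HOL-Algebra.Coset"
begin

text \<open>The inherited monoid structure is the law \<open>*\<close>; the unit \<open>\<one>\<close> is shared by both laws.\<close>

record 'a digroup = "'a monoid" +
  circ :: "['a, 'a] \<Rightarrow> 'a"  (infixl "\<diamondop>\<index>" 70)

definition circ_monoid :: "('a, 'm) digroup_scheme \<Rightarrow> 'a monoid" where
  "circ_monoid X = \<lparr>carrier = carrier X, monoid.mult = circ X, one = one X\<rparr>"

locale digroup = group X for X (structure) +
  assumes circ_group: "group (circ_monoid X)"

definition lam :: "('a, 'm) digroup_scheme \<Rightarrow> 'a \<Rightarrow> 'a \<Rightarrow> 'a" where
  "lam X a b = inv\<^bsub>X\<^esub> a \<otimes>\<^bsub>X\<^esub> (a \<diamondop>\<^bsub>X\<^esub> b)"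

locale left_skew_brace = digroup X for X (structure) +
  assumes skew_distrib: "\<lbrakk>a \<in> carrier X; b \<in> carrier X; c \<in> carrier X\<rbrakk>
    \<Longrightarrow> a \<diamondop> (b \<otimes> c) = (a \<diamondop> b) \<otimes> inv a \<otimes> (a \<diamondop> c)"

definition digroup_hom ::
    "('a, 'm) digroup_scheme \<Rightarrow> ('b, 'n) digroup_scheme \<Rightarrow> ('a \<Rightarrow> 'b) set" where
  "digroup_hom X Y = hom X Y \<inter> hom (circ_monoid X) (circ_monoid Y)"

locale digroup_split_epi = X: digroup X + Y: digroup Y
  for X :: "('a, 'm) digroup_scheme" and Y :: "('b, 'n) digroup_scheme"
    and f :: "'a \<Rightarrow> 'b" and s :: "'b \<Rightarrow> 'a" +
  assumes f_hom: "f \<in> digroup_hom X Y"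
    and s_hom: "s \<in> digroup_hom Y X"
    and f_s: "y \<in> carrier Y \<Longrightarrow> f (s y) = y"

text \<open>Left skew braces form a full subcategory of digroups, so the morphisms are unchanged.\<close>

locale skew_brace_split_epi = X: left_skew_brace X + Y: left_skew_brace Y
  for X :: "('a, 'm) digroup_scheme" and Y :: "('b, 'n) digroup_scheme"
    and f :: "'a \<Rightarrow> 'b" and s :: "'b \<Rightarrow> 'a" +
  assumes f_hom: "f \<in> digroup_hom X Y"
    and s_hom: "s \<in> digroup_hom Y X"
    and f_s: "y \<in> carrier Y \<Longrightarrow> f (s y) = y"

end

theory Submission
  imports Defs
begin

text \<open>If \<open>\<lambda>\<^sub>a\<close> is a \<open>*\<close>-endomorphism then \<open>\<lambda>\<^bsub>a \<circ> b\<^esub> c = \<lambda>\<^sub>a (\<lambda>\<^sub>b c)\<close>, so the elements \<open>a\<close> whose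
  \<open>\<lambda>\<^sub>a\<close> is an endomorphism are closed under \<open>\<circ>\<close>. Every \<open>x \<in> X\<close> factors as \<open>k \<circ> s (f x)\<close> with
  \<open>k\<close> in the kernel, hence condition 2 makes \<open>X\<close> a left skew brace. The skew brace identity then
  passes to \<open>Y\<close> because \<open>s\<close> embeds \<open>Y\<close> in \<open>X\<close> with retraction \<open>f\<close>.\<close>

context digroup
begin

lemma circ_closed [simp, intro]:
  "a \<in> carrier X \<Longrightarrow> b \<in> carrier X \<Longrightarrow> a \<diamondop> b \<in> carrier X"
  using monoid.m_closed[OF group.is_monoid[OF circ_group], of a b]
  by (simp add: circ_monoid_def)

lemma circ_assoc:
  "a \<in> carrier X \<Longrightarrow> b \<in> carrier X \<Longrightarrow> c \<in> carrier X \<Longrightarrow> a \<diamondop> b \<diamondop> c = a \<diamondop> (b \<diamondop> c)"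
  using monoid.m_assoc[OF group.is_monoid[OF circ_group], of a b c]
  by (simp add: circ_monoid_def)

lemma circ_one [simp]: "a \<in> carrier X \<Longrightarrow> a \<diamondop> \<one> = a"
  using monoid.r_one[OF group.is_monoid[OF circ_group], of a]
  by (simp add: circ_monoid_def)

text \<open>Phrased as an existence rule so that later proofs need no notation for inverses in
  \<open>circ_monoid X\<close>; \<open>inv\<close> always refers to the law
  \<open>*\<close>.\<close>

lemma circ_inverse_exists:
  assumes "a \<in> carrier X"
  obtains a' where "a' \<in> carrier X" "a \<diamondop> a' = \<one>" "a' \<diamondop> a = \<one>"
  using group.r_inv[OF circ_group, of a] group.l_inv[OF circ_group, of a]
    group.inv_closed[OF circ_group, of a] assms
  by (auto simp: circ_monoid_def)

lemma lam_closed [simp, intro]: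
  "a \<in> carrier X \<Longrightarrow> b \<in> carrier X \<Longrightarrow> lam X a b \<in> carrier X"
  by (simp add: lam_def)

lemma circ_eq_mult_lam:
  "a \<in> carrier X \<Longrightarrow> b \<in> carrier X \<Longrightarrow> a \<diamondop> b = a \<otimes> lam X a b"
  by (simp add: lam_def m_assoc[symmetric])

text \<open>Both sides of the homomorphism equation begin with \<open>inv a\<close>; cancelling it
  leaves the skew brace identity. Keeping \<open>a\<close> fixed lets the identity be checked one
  left factor at a time.\<close>

lemma lam_hom_iff:
  assumes a: "a \<in> carrier X"
  shows "lam X a \<in> hom X X \<longleftrightarrow> (\<forall>b\<in>carrier X. \<forall>c\<in>carrier X.
    a \<diamondop> (b \<otimes> c) = (a \<diamondop> b) \<otimes> inv a \<otimes> (a \<diamondop> c))"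
proof -
  have "lam X a (b \<otimes> c) = lam X a b \<otimes> lam X a c \<longleftrightarrow>
      a \<diamondop> (b \<otimes> c) = (a \<diamondop> b) \<otimes> inv a \<otimes> (a \<diamondop> c)"
    if "b \<in> carrier X" "c \<in> carrier X" for b c
    using a that by (simp add: lam_def m_assoc)
  then show ?thesis
    using a by (auto simp: hom_def)
qed

text \<open>Expand \<open>a \<diamondop> (b \<diamondop> c)\<close> in two ways through
  \<open>circ_eq_mult_lam\<close>, once around \<open>a \<diamondop> b\<close> and once around
  \<open>a\<close>, then cancel \<open>a \<diamondop> b\<close>.\<close>

lemma lam_circ:
  assumes a: "a \<in> carrier X" and hom: "lam X a \<in> hom X X"
    and b: "b \<in> carrier X" and c: "c \<in> carrier X"
  shows "lam X (a \<diamondop> b) c = lam X a (lam X b c)"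
proof -
  have "(a \<diamondop> b) \<otimes> lam X (a \<diamondop> b) c = a \<diamondop> (b \<diamondop> c)"
    using a b c by (simp add: circ_eq_mult_lam[symmetric] circ_assoc)
  also have "\<dots> = a \<otimes> lam X a (b \<otimes> lam X b c)"
    using a b c by (simp add: circ_eq_mult_lam[symmetric])
  \<comment> \<open>The endomorphism hypothesis on \<open>lam X a\<close> enters here;
    \<open>lam X b\<close> may be an arbitrary map.\<close>
  also have "\<dots> = a \<otimes> (lam X a b \<otimes> lam X a (lam X b c))"
    using a b c hom by (simp add: hom_mult)
  also have "\<dots> = (a \<diamondop> b) \<otimes> lam X a (lam X b c)"
    using a b c by (simp add: circ_eq_mult_lam m_assoc)
  finally show ?thesis
    using a b c by simp
qed

text \<open>By \<open>lam_circ\<close> the map is a composite of two endomorphisms.\<close>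

lemma lam_circ_hom:
  assumes "a \<in> carrier X" "b \<in> carrier X"
    and "lam X a \<in> hom X X" "lam X b \<in> hom X X"
  shows "lam X (a \<diamondop> b) \<in> hom X X"
  using assms by (auto simp: hom_def[of X X] lam_circ)

lemma left_skew_brace_iff_lam_hom:
  "left_skew_brace X \<longleftrightarrow> (\<forall>a\<in>carrier X. lam X a \<in> hom X X)"
  by (auto simp: left_skew_brace_def left_skew_brace_axioms_def lam_hom_iff digroup_axioms)

end

lemma digroup_homD:
  assumes "f \<in> digroup_hom X Y"
  shows "a \<in> carrier X \<Longrightarrow> f a \<in> carrier Y"
    and "\<lbrakk>a \<in> carrier X; b \<in> carrier X\<rbrakk> \<Longrightarrow> f (a \<otimes>\<^bsub>X\<^esub> b) = f a \<otimes>\<^bsub>Y\<^esub> f b"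
    and "\<lbrakk>a \<in> carrier X; b \<in> carrier X\<rbrakk> \<Longrightarrow> f (a \<diamondop>\<^bsub>X\<^esub> b) = f a \<diamondop>\<^bsub>Y\<^esub> f b"
  using assms by (auto simp: digroup_hom_def hom_def circ_monoid_def)

context digroup_split_epi
begin

lemmas f_simps = digroup_homD[OF f_hom]
lemmas s_simps = digroup_homD[OF s_hom]

lemma f_inv: "a \<in> carrier X \<Longrightarrow> f (inv\<^bsub>X\<^esub> a) = inv\<^bsub>Y\<^esub> f a"
  using f_hom by (intro group_hom.hom_inv group_hom.intro group_hom_axioms.intro)
    (auto simp: digroup_hom_def X.is_group Y.is_group)

lemma kernel_section_decomposition:
  assumes x: "x \<in> carrier X"
  obtains k where "k \<in> kernel X Y f" "x = k \<diamondop>\<^bsub>X\<^esub> s (f x)"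
proof -
  have sx: "s (f x) \<in> carrier X" "f x \<in> carrier Y"
    using x by (auto simp: f_simps s_simps)
  obtain t where t: "t \<in> carrier X" "s (f x) \<diamondop>\<^bsub>X\<^esub> t = \<one>\<^bsub>X\<^esub>" "t \<diamondop>\<^bsub>X\<^esub> s (f x) = \<one>\<^bsub>X\<^esub>"
    using X.circ_inverse_exists[OF sx(1)] .
  \<comment> \<open>The kernel factor is \<open>x \<diamondop> t\<close>, with \<open>t\<close> the
    inverse of \<open>s (f x)\<close> for the second law. Since \<open>f\<close> retracts
    \<open>s\<close>, replacing \<open>x\<close> by \<open>s (f x)\<close> does not change the
    image.\<close>
  have "f (x \<diamondop>\<^bsub>X\<^esub> t) = f (s (f x) \<diamondop>\<^bsub>X\<^esub> t)"
    using x t(1) sx by (simp add: f_simps f_s)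
  also have "\<dots> = \<one>\<^bsub>Y\<^esub>"
    using t(2) f_hom by (simp add: digroup_hom_def hom_one X.is_group Y.is_group)
  finally have "x \<diamondop>\<^bsub>X\<^esub> t \<in> kernel X Y f"
    using x t(1) by (simp add: kernel_def)
  moreover have "x = (x \<diamondop>\<^bsub>X\<^esub> t) \<diamondop>\<^bsub>X\<^esub> s (f x)"
    using x t sx by (simp add: X.circ_assoc)
  ultimately show thesis
    by (rule that)
qed

lemma left_skew_brace_codomain:
  assumes "left_skew_brace X"
  shows "left_skew_brace Y"
proof
  fix a b c assume abc: "a \<in> carrier Y" "b \<in> carrier Y" "c \<in> carrier Y"
  then have "s a \<diamondop>\<^bsub>X\<^esub> (s b \<otimes>\<^bsub>X\<^esub> s c) =
      (s a \<diamondop>\<^bsub>X\<^esub> s b) \<otimes>\<^bsub>X\<^esub> inv\<^bsub>X\<^esub> s a \<otimes>\<^bsub>X\<^esub> (s a \<diamondop>\<^bsub>X\<^esub> s c)"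
    by (intro left_skew_brace.skew_distrib[OF assms] s_simps)
  \<comment> \<open>Applying \<open>f\<close> to the identity in \<open>X\<close> returns each
    \<open>s a\<close> to \<open>a\<close>.\<close>
  then have "f (s a \<diamondop>\<^bsub>X\<^esub> (s b \<otimes>\<^bsub>X\<^esub> s c)) =
      f ((s a \<diamondop>\<^bsub>X\<^esub> s b) \<otimes>\<^bsub>X\<^esub> inv\<^bsub>X\<^esub> s a \<otimes>\<^bsub>X\<^esub> (s a \<diamondop>\<^bsub>X\<^esub> s c))"
    by (rule arg_cong)
  then show "a \<diamondop>\<^bsub>Y\<^esub> (b \<otimes>\<^bsub>Y\<^esub> c) = (a \<diamondop>\<^bsub>Y\<^esub> b) \<otimes>\<^bsub>Y\<^esub> inv\<^bsub>Y\<^esub> a \<otimes>\<^bsub>Y\<^esub> (a \<diamondop>\<^bsub>Y\<^esub> c)"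
    using abc by (simp add: f_simps s_simps(1) f_inv f_s)
qed

text \<open>The morphisms are the same in both categories and the brace property descends to
  \<open>Y\<close>, so only \<open>X\<close> has to be examined.\<close>

lemma skew_brace_split_epi_iff: "skew_brace_split_epi X Y f s \<longleftrightarrow> left_skew_brace X"
  using left_skew_brace_codomain f_hom s_hom f_s
  by (auto simp: skew_brace_split_epi_def skew_brace_split_epi_axioms_def)

end

theorem theorem3p2:
  fixes X :: "('a, 'm) digroup_scheme" and Y :: "('b, 'n) digroup_scheme"
    and f :: "'a \<Rightarrow> 'b" and s :: "'b \<Rightarrow> 'a"
  assumes "digroup_split_epi X Y f s"
  shows "skew_brace_split_epi X Y f s \<longleftrightarrow>
    (\<forall>y \<in> carrier Y. \<forall>k \<in> kernel X Y f. lam X (s y) \<in> hom X X \<and> lam X k \<in> hom X X)"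
proof -
  interpret digroup_split_epi X Y f s by (rule assms)
  have "lam X x \<in> hom X X"
    if lam: "\<forall>y \<in> carrier Y. \<forall>k \<in> kernel X Y f. lam X (s y) \<in> hom X X \<and> lam X k \<in> hom X X"
      and x: "x \<in> carrier X" for x
  proof -
    obtain k where k: "k \<in> kernel X Y f" "x = k \<diamondop>\<^bsub>X\<^esub> s (f x)"
      using kernel_section_decomposition[OF x] .
    have "f x \<in> carrier Y"
      using x by (rule f_simps)
    \<comment> \<open>Condition 2 at the pair \<open>(f x, k)\<close> supplies both factors.\<close>
    then have "lam X (k \<diamondop>\<^bsub>X\<^esub> s (f x)) \<in> hom X X"
      using lam k(1) by (intro X.lam_circ_hom) (auto simp: kernel_def s_simps)
    then show ?thesis
      using k(2) by simp
  qed
  moreover have "s y \<in> carrier X" if "y \<in> carrier Y" for y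
    using that by (rule s_simps)
  ultimately show ?thesis
    unfolding skew_brace_split_epi_iff X.left_skew_brace_iff_lam_hom
    by (auto simp: kernel_def)
qed

end
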